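(* Let $S$ be a completely regular semigroup. Then $\kappa_k=((\omega_k)_t)_k$ is the least congruence $\rho$ on $S$ for which $\kappa_{S/\rho}$ is over rectangular bands.
   Context: A completely regular semigroup is a semigroup that is a union of its subgroups. A cryptogroup is a completely regular semigroup on which Green's relation $\mathcal{H}$ is a congruence. $E(S)$ is the set of idempotents of $S$ and $\omega$ is the universal relation on $S$. For a congruence $\rho$ on $S$: $\operatorname{tr}\rho=\rho|_{E(S)}$ and $\ker\rho=\{a\in S: a\,\rho\,e\text{ for some }e\in E(S)\}$; $\rho_t$ (resp. $\rho_k$) denotes the least congruence on $S$ with the same trace (resp. the same kernel) as $\rho$. For a completely regular semigroup $T$, $\kappa_T$ is the least congruence on $T$ whose quotient is a cryptogroup; $\kappa=\kappa_S$, and $\kappa=(\omega_k)_t$. A rectangular band is a semigroup satisfying the identity $a=axa$. The congruence $\kappa_T$ is over rectangular bands if the $\kappa_T$-class of each $e\in E(T)$ is a rectangular band. *)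

theory Defs
  imports "HOL-Algebra.Group"
begin

record 'a sgrp = "'a partial_object" +
  smult :: "'a \<Rightarrow> 'a \<Rightarrow> 'a" (infixl \<open>\<cdot>\<index>\<close> 70)

locale sgroup =
  fixes S :: "'a sgrp" (structure)
  assumes closed: "a \<in> carrier S \<Longrightarrow> b \<in> carrier S \<Longrightarrow> a \<cdot> b \<in> carrier S"
    and assoc: "a \<in> carrier S \<Longrightarrow> b \<in> carrier S \<Longrightarrow> c \<in> carrier S \<Longrightarrow> (a \<cdot> b) \<cdot> c = a \<cdot> (b \<cdot> c)"

text \<open>A subgroup of a semigroup has its own identity, which is an idempotent of the semigroup.\<close>

definition subgroups :: "'a sgrp \<Rightarrow> 'a set set" where
  "subgroups S = {G. G \<subseteq> carrier S \<and> (\<exists>e. group \<lparr>carrier = G, mult = smult S, one = e\<rparr>)}"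

definition completely_regular :: "'a sgrp \<Rightarrow> bool" where
  "completely_regular S \<longleftrightarrow> sgroup S \<and> carrier S = \<Union>(subgroups S)"

text \<open>The principal one-sided ideals \<open>S\<^sup>1a\<close> and \<open>aS\<^sup>1\<close>.\<close>

definition left_ideal :: "'a sgrp \<Rightarrow> 'a \<Rightarrow> 'a set" where
  "left_ideal S a = insert a {x \<cdot>\<^bsub>S\<^esub> a | x. x \<in> carrier S}"

definition right_ideal :: "'a sgrp \<Rightarrow> 'a \<Rightarrow> 'a set" where
  "right_ideal S a = insert a {a \<cdot>\<^bsub>S\<^esub> x | x. x \<in> carrier S}"

definition green_L :: "'a sgrp \<Rightarrow> 'a rel" where
  "green_L S = {(a, b) \<in> carrier S \<times> carrier S. left_ideal S a = left_ideal S b}"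

definition green_R :: "'a sgrp \<Rightarrow> 'a rel" where
  "green_R S = {(a, b) \<in> carrier S \<times> carrier S. right_ideal S a = right_ideal S b}"

definition green_H :: "'a sgrp \<Rightarrow> 'a rel" where
  "green_H S = green_L S \<inter> green_R S"

definition congruence :: "'a sgrp \<Rightarrow> 'a rel \<Rightarrow> bool" where
  "congruence S \<rho> \<longleftrightarrow> equiv (carrier S) \<rho> \<and>
     (\<forall>(a, b) \<in> \<rho>. \<forall>(c, d) \<in> \<rho>. (a \<cdot>\<^bsub>S\<^esub> c, b \<cdot>\<^bsub>S\<^esub> d) \<in> \<rho>)"

definition quot_sgrp :: "'a sgrp \<Rightarrow> 'a rel \<Rightarrow> 'a set sgrp" where
  "quot_sgrp S \<rho> =
     \<lparr>carrier = carrier S // \<rho>, smult = (\<lambda>A B. \<Union>a\<in>A. \<Union>b\<in>B. \<rho> `` {a \<cdot>\<^bsub>S\<^esub> b})\<rparr>"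

lemma quot_sgrp_mult:
  assumes "congruence S \<rho>" "a \<in> carrier S" "b \<in> carrier S"
  shows "(\<rho> `` {a}) \<cdot>\<^bsub>quot_sgrp S \<rho>\<^esub> (\<rho> `` {b}) = \<rho> `` {a \<cdot>\<^bsub>S\<^esub> b}"
proof -
  have eq: "equiv (carrier S) \<rho>" using assms(1) unfolding congruence_def by (rule conjunct1)
  have "congruent2 \<rho> \<rho> (\<lambda>x y. \<rho> `` {x \<cdot>\<^bsub>S\<^esub> y})"
  proof (rule congruent2I')
    fix x x' y y' assume "(x, x') \<in> \<rho>" "(y, y') \<in> \<rho>"
    then have "(x \<cdot>\<^bsub>S\<^esub> y, x' \<cdot>\<^bsub>S\<^esub> y') \<in> \<rho>"
      using assms(1) unfolding congruence_def by blast
    then show "\<rho> `` {x \<cdot>\<^bsub>S\<^esub> y} = \<rho> `` {x' \<cdot>\<^bsub>S\<^esub> y'}" by (rule equiv_class_eq[OF eq])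
  qed
  from UN_equiv_class2[OF eq eq this assms(2,3)] show ?thesis
    by (simp only: quot_sgrp_def sgrp.select_convs)
qed

definition cryptogroup :: "'a sgrp \<Rightarrow> bool" where
  "cryptogroup S \<longleftrightarrow> completely_regular S \<and> congruence S (green_H S)"

definition idempotents :: "'a sgrp \<Rightarrow> 'a set" where
  "idempotents S = {e \<in> carrier S. e \<cdot>\<^bsub>S\<^esub> e = e}"

definition omega :: "'a sgrp \<Rightarrow> 'a rel" where
  "omega S = carrier S \<times> carrier S"

definition cong_trace :: "'a sgrp \<Rightarrow> 'a rel \<Rightarrow> 'a rel" where
  "cong_trace S \<rho> = \<rho> \<inter> (idempotents S \<times> idempotents S)"

definition cong_kernel :: "'a sgrp \<Rightarrow> 'a rel \<Rightarrow> 'a set" where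
  "cong_kernel S \<rho> = {a \<in> carrier S. \<exists>e \<in> idempotents S. (a, e) \<in> \<rho>}"

text \<open>
  Congruences are ordered by inclusion. \<open>LEAST\<close> is a definite description: each of the next three
  notions is meaningful only when the least congruence in question exists.
\<close>

definition lower_trace :: "'a sgrp \<Rightarrow> 'a rel \<Rightarrow> 'a rel" where
  "lower_trace S \<rho> = (LEAST \<sigma>. congruence S \<sigma> \<and> cong_trace S \<sigma> = cong_trace S \<rho>)"

definition lower_kernel :: "'a sgrp \<Rightarrow> 'a rel \<Rightarrow> 'a rel" where
  "lower_kernel S \<rho> = (LEAST \<sigma>. congruence S \<sigma> \<and> cong_kernel S \<sigma> = cong_kernel S \<rho>)"

definition kappa :: "'a sgrp \<Rightarrow> 'a rel" where
  "kappa S = (LEAST \<sigma>. congruence S \<sigma> \<and> cryptogroup (quot_sgrp S \<sigma>))"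

definition rectangular_band :: "'a sgrp \<Rightarrow> bool" where
  "rectangular_band B \<longleftrightarrow> sgroup B \<and>
     (\<forall>a \<in> carrier B. \<forall>x \<in> carrier B. a = a \<cdot>\<^bsub>B\<^esub> x \<cdot>\<^bsub>B\<^esub> a)"

definition over_rectangular_bands :: "'a sgrp \<Rightarrow> 'a rel \<Rightarrow> bool" where
  "over_rectangular_bands S \<rho> \<longleftrightarrow>
     (\<forall>e \<in> idempotents S. rectangular_band \<lparr>carrier = \<rho> `` {e}, smult = smult S\<rparr>)"

end

theory Submission
  imports Defs
begin

text \<open>
  The quotient \<open>S/\<sigma>\<close> is a cryptogroup iff \<open>(ab)\<^sup>0 \<sigma> (a\<^sup>0b\<^sup>0)\<^sup>0\<close> for all \<open>a, b\<close>, a condition that passes to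
  intersections and to quotients. The congruence \<open>\<omega>\<^sub>k\<close> is the least band congruence, and comparing it
  with \<open>{(a, b). a\<^sup>0 \<kappa> b\<^sup>0}\<close> shows that it has the same trace as \<open>\<kappa>\<close>, whence \<open>\<kappa> = (\<omega>\<^sub>k)\<^sub>t\<close>.
  Moreover \<open>\<kappa>\<close> is contained in \<open>\<omega>\<^sub>k\<close>, hence in Green's relation \<open>\<J>\<close>, whose quotient is a semilattice;
  so \<open>\<kappa>\<close> is over rectangular bands as soon as its kernel consists of idempotents.
  In \<open>S/\<rho>\<close> this forces \<open>ker \<kappa> \<subseteq> ker \<rho>\<close>, that is, \<open>\<kappa>\<^sub>k \<subseteq> \<rho>\<close>, and for \<open>\<rho> = \<kappa>\<^sub>k\<close> it holds because
  \<open>\<kappa>\<close> induces on \<open>S/\<rho>\<close> a congruence with cryptogroup quotient.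
\<close>

section \<open>Congruences, quotients and the correspondence between them\<close>

lemma congruenceI:
  assumes "\<rho> \<subseteq> carrier S \<times> carrier S" "\<And>a. a \<in> carrier S \<Longrightarrow> (a, a) \<in> \<rho>"
    and "\<And>a b. (a, b) \<in> \<rho> \<Longrightarrow> (b, a) \<in> \<rho>"
    and "\<And>a b c. (a, b) \<in> \<rho> \<Longrightarrow> (b, c) \<in> \<rho> \<Longrightarrow> (a, c) \<in> \<rho>"
    and "\<And>a b c d. (a, b) \<in> \<rho> \<Longrightarrow> (c, d) \<in> \<rho> \<Longrightarrow> (a \<cdot>\<^bsub>S\<^esub> c, b \<cdot>\<^bsub>S\<^esub> d) \<in> \<rho>"
  shows "congruence S \<rho>"
  unfolding congruence_def equiv_def refl_on_def sym_def trans_def using assms by blast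

lemma
  assumes "congruence S \<rho>"
  shows congruence_equiv: "equiv (carrier S) \<rho>"
    and congruence_refl: "\<And>a. a \<in> carrier S \<Longrightarrow> (a, a) \<in> \<rho>"
    and congruence_sym: "\<And>a b. (a, b) \<in> \<rho> \<Longrightarrow> (b, a) \<in> \<rho>"
    and congruence_trans: "\<And>a b c. (a, b) \<in> \<rho> \<Longrightarrow> (b, c) \<in> \<rho> \<Longrightarrow> (a, c) \<in> \<rho>"
    and congruence_mult: "\<And>a b c d. (a, b) \<in> \<rho> \<Longrightarrow> (c, d) \<in> \<rho> \<Longrightarrow> (a \<cdot>\<^bsub>S\<^esub> c, b \<cdot>\<^bsub>S\<^esub> d) \<in> \<rho>"
    and congruence_dom: "\<And>a b. (a, b) \<in> \<rho> \<Longrightarrow> a \<in> carrier S"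
    and congruence_ran: "\<And>a b. (a, b) \<in> \<rho> \<Longrightarrow> b \<in> carrier S"
proof -
  show eq: "equiv (carrier S) \<rho>"
    using assms by (simp add: congruence_def)
  then have sub: "\<rho> \<subseteq> carrier S \<times> carrier S" by (rule equiv_type)
  show "(a, a) \<in> \<rho>" if "a \<in> carrier S" for a
    using eq that by (auto elim: equivE dest: refl_onD)
  show "(b, a) \<in> \<rho>" if "(a, b) \<in> \<rho>" for a b
    using eq that by (auto elim: equivE dest: symD)
  show "(a, c) \<in> \<rho>" if "(a, b) \<in> \<rho>" "(b, c) \<in> \<rho>" for a b c
    using eq that by (auto elim: equivE dest: transD)
  show "(a \<cdot>\<^bsub>S\<^esub> c, b \<cdot>\<^bsub>S\<^esub> d) \<in> \<rho>" if "(a, b) \<in> \<rho>" "(c, d) \<in> \<rho>" for a b c d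
    using assms that unfolding congruence_def by fast
  show "a \<in> carrier S" "b \<in> carrier S" if "(a, b) \<in> \<rho>" for a b
    using sub that by auto
qed

lemma congruence_Inter:
  assumes "F \<noteq> {}" "\<And>\<rho>. \<rho> \<in> F \<Longrightarrow> congruence S \<rho>"
  shows "congruence S (\<Inter>F)"
proof (rule congruenceI)
  show "\<Inter>F \<subseteq> carrier S \<times> carrier S"
    using assms congruence_dom congruence_ran by fastforce
qed (auto intro: assms(2) congruence_refl congruence_sym congruence_trans congruence_mult)

lemma congruence_omega: "sgroup S \<Longrightarrow> congruence S (omega S)"
  by (rule congruenceI) (auto simp: omega_def sgroup.closed)

lemma quot_class_eq_iff:
  assumes "congruence S \<rho>" "a \<in> carrier S" "b \<in> carrier S"
  shows "\<rho> `` {a} = \<rho> `` {b} \<longleftrightarrow> (a, b) \<in> \<rho>"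
  using eq_equiv_class_iff[OF congruence_equiv[OF assms(1)]] assms(2,3) by blast

lemma quot_carrier: "carrier (quot_sgrp S \<rho>) = {\<rho> `` {a} | a. a \<in> carrier S}"
  by (auto simp: quot_sgrp_def quotient_def)

lemma quot_class_in_carrier: "a \<in> carrier S \<Longrightarrow> \<rho> `` {a} \<in> carrier (quot_sgrp S \<rho>)"
  by (auto simp: quot_carrier)

lemma sgroup_quot:
  assumes "sgroup S" "congruence S \<rho>"
  shows "sgroup (quot_sgrp S \<rho>)"
proof
  interpret sgroup S by fact
  fix A B C
  assume "A \<in> carrier (quot_sgrp S \<rho>)" "B \<in> carrier (quot_sgrp S \<rho>)"
  then obtain a b where ab: "a \<in> carrier S" "b \<in> carrier S" "A = \<rho> `` {a}" "B = \<rho> `` {b}"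
    unfolding quot_carrier by blast
  then show "A \<cdot>\<^bsub>quot_sgrp S \<rho>\<^esub> B \<in> carrier (quot_sgrp S \<rho>)"
    by (simp add: quot_sgrp_mult[OF assms(2)] closed quot_class_in_carrier)
  assume "C \<in> carrier (quot_sgrp S \<rho>)"
  then obtain c where "c \<in> carrier S" "C = \<rho> `` {c}"
    unfolding quot_carrier by blast
  with ab show "A \<cdot>\<^bsub>quot_sgrp S \<rho>\<^esub> B \<cdot>\<^bsub>quot_sgrp S \<rho>\<^esub> C = A \<cdot>\<^bsub>quot_sgrp S \<rho>\<^esub> (B \<cdot>\<^bsub>quot_sgrp S \<rho>\<^esub> C)"
    by (simp add: quot_sgrp_mult[OF assms(2)] closed assoc)
qed

text \<open>The preimage of \<open>\<tau>\<close> under the projection onto the quotient. Applied to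
  \<open>kappa\<close> of the quotient, it yields a congruence on \<open>S\<close> that can be
  compared with \<open>kappa S\<close>.\<close>

lemma congruence_pullback:
  assumes "sgroup S" "congruence S \<rho>" "congruence (quot_sgrp S \<rho>) \<tau>"
  shows "congruence S {(a, b) \<in> carrier S \<times> carrier S. (\<rho> `` {a}, \<rho> `` {b}) \<in> \<tau>}"
proof -
  interpret sgroup S by fact
  show ?thesis
    by (rule congruenceI)
      (auto simp: closed quot_class_in_carrier simp flip: quot_sgrp_mult[OF assms(2)]
        intro: congruence_refl[OF assms(3)] congruence_sym[OF assms(3)]
          congruence_trans[OF assms(3)] congruence_mult[OF assms(3)])
qed

text \<open>For \<open>\<rho> \<subseteq> \<tau>\<close> this is the congruence
  \<open>\<tau>/\<rho>\<close> of the correspondence theorem.\<close>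

definition pushforward :: "'a rel \<Rightarrow> 'a rel \<Rightarrow> 'a set rel" where
  "pushforward \<rho> \<tau> = {(\<rho> `` {a}, \<rho> `` {b}) | a b. (a, b) \<in> \<tau>}"

text \<open>The inclusion \<open>\<rho> \<subseteq> \<tau>\<close> makes membership independent of
  the representatives: replacing \<open>a\<close> or \<open>b\<close> inside its
  \<open>\<rho>\<close>-class is a step within \<open>\<tau>\<close>.\<close>

lemma pushforward_iff:
  assumes "congruence S \<rho>" "congruence S \<tau>" "\<rho> \<subseteq> \<tau>" "a \<in> carrier S" "b \<in> carrier S"
  shows "(\<rho> `` {a}, \<rho> `` {b}) \<in> pushforward \<rho> \<tau> \<longleftrightarrow> (a, b) \<in> \<tau>"
proof
  assume "(\<rho> `` {a}, \<rho> `` {b}) \<in> pushforward \<rho> \<tau>"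
  then obtain c d where cd: "\<rho> `` {a} = \<rho> `` {c}" "\<rho> `` {b} = \<rho> `` {d}" "(c, d) \<in> \<tau>"
    by (auto simp: pushforward_def)
  then have "(a, c) \<in> \<tau>" "(b, d) \<in> \<tau>"
    using quot_class_eq_iff[OF assms(1)] assms congruence_dom[OF assms(2)] congruence_ran[OF assms(2)]
    by blast+
  with cd(3) show "(a, b) \<in> \<tau>"
    using congruence_sym[OF assms(2)] congruence_trans[OF assms(2)] by blast
qed (auto simp: pushforward_def)

lemma congruence_pushforward:
  assumes "congruence S \<rho>" "congruence S \<tau>" "\<rho> \<subseteq> \<tau>"
  shows "congruence (quot_sgrp S \<rho>) (pushforward \<rho> \<tau>)"
proof -
  note iff = pushforward_iff[OF assms]
  have sub: "pushforward \<rho> \<tau> \<subseteq> carrier (quot_sgrp S \<rho>) \<times> carrier (quot_sgrp S \<rho>)"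
    using congruence_dom[OF assms(2)] congruence_ran[OF assms(2)]
    by (fastforce simp: pushforward_def quot_carrier)
  show ?thesis
  proof (rule congruenceI[OF sub])
    fix A assume "A \<in> carrier (quot_sgrp S \<rho>)"
    then show "(A, A) \<in> pushforward \<rho> \<tau>"
      using congruence_refl[OF assms(2)] by (fastforce simp: pushforward_def quot_carrier)
  next
    fix A B assume "(A, B) \<in> pushforward \<rho> \<tau>"
    then show "(B, A) \<in> pushforward \<rho> \<tau>"
      using congruence_sym[OF assms(2)] by (fastforce simp: pushforward_def)
  next
    fix A B C assume AB: "(A, B) \<in> pushforward \<rho> \<tau>" and BC: "(B, C) \<in> pushforward \<rho> \<tau>"
    from AB BC sub obtain a b c where "a \<in> carrier S" "b \<in> carrier S" "c \<in> carrier S"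
      "A = \<rho> `` {a}" "B = \<rho> `` {b}" "C = \<rho> `` {c}"
      unfolding quot_carrier by blast
    with AB BC show "(A, C) \<in> pushforward \<rho> \<tau>"
      using congruence_trans[OF assms(2)] by (simp add: iff)
  next
    fix A B C D assume "(A, B) \<in> pushforward \<rho> \<tau>" "(C, D) \<in> pushforward \<rho> \<tau>"
    then obtain a b c d where *: "(a, b) \<in> \<tau>" "(c, d) \<in> \<tau>"
      "A = \<rho> `` {a}" "B = \<rho> `` {b}" "C = \<rho> `` {c}" "D = \<rho> `` {d}"
      unfolding pushforward_def by blast
    then show "(A \<cdot>\<^bsub>quot_sgrp S \<rho>\<^esub> C, B \<cdot>\<^bsub>quot_sgrp S \<rho>\<^esub> D) \<in> pushforward \<rho> \<tau>"
      using congruence_mult[OF assms(2) *(1,2)] congruence_dom[OF assms(2)] congruence_ran[OF assms(2)]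
      by (auto simp: quot_sgrp_mult[OF assms(1)] pushforward_def)
  qed
qed

section \<open>Maximal subgroups and their identities in completely regular semigroups\<close>

text \<open>An elementwise form of complete regularity, easier to pass to quotients than a union of
  subgroups; \<open>completely_regular_iff\<close> shows the two equivalent.\<close>

locale cr_sgroup = sgroup +
  assumes commuting_inverse_exists:
    "a \<in> carrier S \<Longrightarrow> \<exists>x\<in>carrier S. a \<cdot> x \<cdot> a = a \<and> a \<cdot> x = x \<cdot> a"
begin

text \<open>An arbitrary commuting inner inverse, which may lie outside the maximal subgroup of
  \<open>a\<close>. By \<open>idem_unique\<close> its product with \<open>a\<close> is the same for
  every choice.\<close>

definition inverse_of :: "'a \<Rightarrow> 'a" where
  "inverse_of a = (SOME x. x \<in> carrier S \<and> a \<cdot> x \<cdot> a = a \<and> a \<cdot> x = x \<cdot> a)"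

text \<open>The element \<open>a\<^sup>0\<close>, the identity of the maximal subgroup containing \<open>a\<close>.\<close>

definition idem :: "'a \<Rightarrow> 'a" where
  "idem a = a \<cdot> inverse_of a"

lemma
  assumes "a \<in> carrier S"
  shows inverse_of_closed [simp]: "inverse_of a \<in> carrier S"
    and inverse_of_regular: "a \<cdot> inverse_of a \<cdot> a = a"
    and inverse_of_commute: "inverse_of a \<cdot> a = a \<cdot> inverse_of a"
proof -
  from commuting_inverse_exists[OF assms]
  have "\<exists>x. x \<in> carrier S \<and> a \<cdot> x \<cdot> a = a \<and> a \<cdot> x = x \<cdot> a" by blast
  from someI_ex[OF this, folded inverse_of_def]
  show "inverse_of a \<in> carrier S" "a \<cdot> inverse_of a \<cdot> a = a"
    "inverse_of a \<cdot> a = a \<cdot> inverse_of a" by metis+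
qed

declare closed [simp]

lemma idem_closed [simp]: "a \<in> carrier S \<Longrightarrow> idem a \<in> carrier S"
  by (simp add: idem_def)

lemma idem_left [simp]: "a \<in> carrier S \<Longrightarrow> idem a \<cdot> a = a"
  by (simp add: idem_def inverse_of_regular)

lemma idem_right [simp]: "a \<in> carrier S \<Longrightarrow> a \<cdot> idem a = a"
  by (metis assoc idem_def inverse_of_closed inverse_of_commute inverse_of_regular)

lemma idem_inverse_left: "a \<in> carrier S \<Longrightarrow> inverse_of a \<cdot> a = idem a"
  by (simp add: idem_def inverse_of_commute)

text \<open>With \<open>y\<close> the chosen inverse, \<open>ax = yaax = y(axa) = ya\<close>. Any
  commuting inner inverse thus computes \<open>idem a\<close>, which is how \<open>idem\<close> is
  identified in quotients and in subgroups.\<close>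

lemma idem_unique:
  assumes "a \<in> carrier S" "x \<in> carrier S" "a \<cdot> x \<cdot> a = a" "a \<cdot> x = x \<cdot> a"
  shows "idem a = a \<cdot> x"
proof -
  let ?y = "inverse_of a"
  have "a \<cdot> x = (?y \<cdot> a \<cdot> a) \<cdot> x"
    using assms by (simp add: idem_inverse_left)
  also have "\<dots> = ?y \<cdot> (a \<cdot> x \<cdot> a)"
    using assms(1,2,4) by (metis assoc closed inverse_of_closed)
  also have "\<dots> = idem a"
    using assms by (simp add: idem_inverse_left)
  finally show ?thesis ..
qed

lemma idem_idempotent: "a \<in> carrier S \<Longrightarrow> idem a \<cdot> idem a = idem a"
  by (metis assoc idem_closed idem_def idem_left inverse_of_closed)

lemma idempotents_idem [simp]: "a \<in> carrier S \<Longrightarrow> idem a \<in> idempotents S"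
  by (simp add: idempotents_def idem_idempotent)

lemma idem_of_idempotent [simp]: "e \<in> idempotents S \<Longrightarrow> idem e = e"
  using idem_unique[of e e] by (simp add: idempotents_def)

lemma idempotents_closed: "e \<in> idempotents S \<Longrightarrow> e \<in> carrier S"
  by (simp add: idempotents_def)

text \<open>Each \<open>\<H>\<close>-class is a maximal subgroup and is determined by its identity.
  In one direction the ideals show that \<open>idem b \<cdot> idem a\<close> equals both
  idempotents; in the other, \<open>c = (c \<cdot> inverse_of d) \<cdot> d\<close> and its dual give
  the ideal inclusions.\<close>

lemma green_H_iff:
  assumes a: "a \<in> carrier S" and b: "b \<in> carrier S"
  shows "(a, b) \<in> green_H S \<longleftrightarrow> idem a = idem b"
proof
  have left: "c \<cdot> idem d = c"
    if "left_ideal S c = left_ideal S d" "c \<in> carrier S" "d \<in> carrier S" for c d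
  proof -
    have "c \<in> left_ideal S d" using that(1) by (auto simp: left_ideal_def)
    then show ?thesis using that(2,3) by (auto simp: left_ideal_def assoc)
  qed
  have right: "idem d \<cdot> c = c"
    if "right_ideal S c = right_ideal S d" "c \<in> carrier S" "d \<in> carrier S" for c d
  proof -
    have "c \<in> right_ideal S d" using that(1) by (auto simp: right_ideal_def)
    then show ?thesis using that(2,3) by (auto simp: right_ideal_def assoc[symmetric])
  qed
  assume "(a, b) \<in> green_H S"
  then have "left_ideal S b = left_ideal S a" "right_ideal S a = right_ideal S b"
    by (auto simp: green_H_def green_L_def green_R_def)
  then have ba: "b \<cdot> idem a = b" and "idem b \<cdot> a = a"
    using left right a b by blast+
  have "idem b \<cdot> idem a = idem b"
    using ba a b by (metis assoc idem_closed idem_inverse_left inverse_of_closed)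
  moreover have "idem b \<cdot> idem a = idem a"
    using \<open>idem b \<cdot> a = a\<close> a b by (metis assoc idem_closed idem_def inverse_of_closed)
  ultimately show "idem a = idem b" by simp
next
  have left: "left_ideal S c \<subseteq> left_ideal S d"
    if "idem c = idem d" and cd: "c \<in> carrier S" "d \<in> carrier S" for c d
  proof -
    have "c = (c \<cdot> inverse_of d) \<cdot> d"
      using that by (metis assoc idem_inverse_left idem_right inverse_of_closed)
    then obtain p where "c = p \<cdot> d" "p \<in> carrier S"
      using cd by (metis closed inverse_of_closed)
    then show ?thesis using cd by (auto simp: left_ideal_def simp flip: assoc)
  qed
  have right: "right_ideal S c \<subseteq> right_ideal S d"
    if "idem c = idem d" and cd: "c \<in> carrier S" "d \<in> carrier S" for c d
  proof -
    have "c = d \<cdot> (inverse_of d \<cdot> c)"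
      using that by (metis assoc idem_def idem_left inverse_of_closed)
    then obtain p where "c = d \<cdot> p" "p \<in> carrier S"
      using cd by (metis closed inverse_of_closed)
    then show ?thesis using cd by (auto simp: right_ideal_def assoc)
  qed
  assume "idem a = idem b"
  then have "left_ideal S a = left_ideal S b" "right_ideal S a = right_ideal S b"
    using left[of a b] left[of b a] right[of a b] right[of b a] a b by auto
  then show "(a, b) \<in> green_H S"
    using a b by (auto simp: green_H_def green_L_def green_R_def)
qed

text \<open>With \<open>x\<close>, \<open>y\<close> the chosen inverses of \<open>a\<close>,
  \<open>b\<close>, the chain is \<open>idem a\<close>, \<open>xb\<close>,
  \<open>idem a \<cdot> idem b\<close>, \<open>ay\<close>, \<open>idem b\<close>. The middle links
  come from multiplying the outer ones by \<open>idem b\<close> on the right and by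
  \<open>idem a\<close> on the left.\<close>

lemma idem_cong:
  assumes "congruence S \<rho>" "(a, b) \<in> \<rho>"
  shows "(idem a, idem b) \<in> \<rho>"
proof -
  have ab: "a \<in> carrier S" "b \<in> carrier S"
    using congruence_dom[OF assms] congruence_ran[OF assms] by blast+
  let ?x = "inverse_of a" and ?y = "inverse_of b"
  have "(?x \<cdot> a, ?x \<cdot> b) \<in> \<rho>" and "(a \<cdot> ?y, b \<cdot> ?y) \<in> \<rho>"
    using assms ab by (simp_all add: congruence_mult congruence_refl)
  then have x: "(idem a, ?x \<cdot> b) \<in> \<rho>" and y: "(a \<cdot> ?y, idem b) \<in> \<rho>"
    using ab by (simp_all add: idem_inverse_left idem_def)
  have "(idem a \<cdot> idem b, ?x \<cdot> b \<cdot> idem b) \<in> \<rho>" "(idem a \<cdot> (a \<cdot> ?y), idem a \<cdot> idem b) \<in> \<rho>"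
    using x y ab assms by (simp_all add: congruence_mult congruence_refl)
  then have "(idem a \<cdot> idem b, ?x \<cdot> b) \<in> \<rho>" "(a \<cdot> ?y, idem a \<cdot> idem b) \<in> \<rho>"
    using ab by (simp_all add: assoc) (simp add: assoc[symmetric])
  with x y show ?thesis
    using congruence_sym[OF assms(1)] congruence_trans[OF assms(1)] by blast
qed

text \<open>If \<open>a\<close> is related to an idempotent \<open>e\<close>, then
  \<open>idem a\<close> is related to \<open>idem e = e\<close>. With the witness fixed as
  \<open>idem a\<close>, independently of \<open>\<rho>\<close>, kernels commute with intersections
  of congruences.\<close>

lemma cong_kernel_iff:
  assumes "congruence S \<rho>" "a \<in> carrier S"
  shows "a \<in> cong_kernel S \<rho> \<longleftrightarrow> (a, idem a) \<in> \<rho>"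
proof
  assume "a \<in> cong_kernel S \<rho>"
  then obtain e where "e \<in> idempotents S" "(a, e) \<in> \<rho>" by (auto simp: cong_kernel_def)
  then have "(idem a, e) \<in> \<rho>" using idem_cong[OF assms(1)] by fastforce
  with \<open>(a, e) \<in> \<rho>\<close> show "(a, idem a) \<in> \<rho>"
    using congruence_sym[OF assms(1)] congruence_trans[OF assms(1)] by blast
qed (use assms in \<open>auto simp: cong_kernel_def\<close>)

lemma cong_kernel_carrier: "cong_kernel S \<rho> \<subseteq> carrier S"
  by (auto simp: cong_kernel_def)

lemma subgroup_of_idempotent:
  assumes e: "e \<in> idempotents S"
  defines "G \<equiv> {b \<in> carrier S. idem b = e}"
  shows "group \<lparr>carrier = G, mult = smult S, one = e\<rparr>"
proof (rule groupI; simp)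
  have ec: "e \<in> carrier S" using e by (rule idempotents_closed)
  have inv: "\<exists>y\<in>carrier S. e \<cdot> y = y \<and> y \<cdot> e = y \<and> y \<cdot> b = e \<and> b \<cdot> y = e" if "b \<in> G" for b
  proof -
    have b: "b \<in> carrier S" "idem b = e" using that by (auto simp: G_def)
    \<comment> \<open>Multiplying by \<open>e\<close> on both sides moves the arbitrary inverse into
      the subgroup with identity \<open>e\<close>.\<close>
    let ?y = "e \<cdot> inverse_of b \<cdot> e"
    have 1: "?y \<cdot> b = e \<cdot> (inverse_of b \<cdot> (e \<cdot> b))" and 2: "b \<cdot> ?y = b \<cdot> e \<cdot> inverse_of b \<cdot> e"
      using b ec by (simp_all add: assoc)
    have eb: "e \<cdot> b = b" "b \<cdot> e = b" "e \<cdot> e = e" using b idem_left[of b] idem_right[of b] e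
      by (auto simp: idempotents_def)
    have "?y \<cdot> b = e" "b \<cdot> ?y = e"
      unfolding 1 2 using eb b by (simp_all add: idem_inverse_left flip: idem_def)
    moreover have "e \<cdot> ?y = ?y" "?y \<cdot> e = ?y"
      using eb(3) ec b by (simp_all add: assoc[of _ e e]) (simp add: assoc[symmetric])
    ultimately show ?thesis using b ec by (intro bexI[of _ ?y]) auto
  qed
  \<comment> \<open>An element with a two-sided inverse relative to \<open>e\<close> belongs to
    \<open>G\<close>, by \<open>idem_unique\<close>; closure under products and inverses both reduce
    to this.\<close>
  have char: "b \<in> G" if "b \<in> carrier S" "y \<in> carrier S" "e \<cdot> b = b" "b \<cdot> y = e" "y \<cdot> b = e" for b y
    using idem_unique[of b y] that by (simp add: G_def)
  show "e \<in> G" using e ec by (simp add: G_def)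
  show "e \<cdot> x = x" if "x \<in> G" for x using that by (auto simp: G_def)
  show "x \<cdot> y \<cdot> z = x \<cdot> (y \<cdot> z)" if "x \<in> G" "y \<in> G" "z \<in> G" for x y z
    using that by (auto simp: G_def assoc)
  show "\<exists>y\<in>G. y \<cdot> x = e" if x: "x \<in> G" for x
  proof -
    obtain y where "y \<in> carrier S" "e \<cdot> y = y" "y \<cdot> x = e" "x \<cdot> y = e" using inv[OF x] by blast
    then show ?thesis using char[of y x] x by (auto simp: G_def)
  qed
  show "x \<cdot> y \<in> G" if x: "x \<in> G" and y: "y \<in> G" for x y
  proof -
    obtain u where u: "u \<in> carrier S" "e \<cdot> u = u" "u \<cdot> e = u" "u \<cdot> x = e" "x \<cdot> u = e"
      using inv[OF x] by blast
    obtain v where v: "v \<in> carrier S" "e \<cdot> v = v" "v \<cdot> e = v" "v \<cdot> y = e" "y \<cdot> v = e"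
      using inv[OF y] by blast
    have xyG: "x \<in> carrier S" "y \<in> carrier S" "idem x = e" "idem y = e"
      using x y by (auto simp: G_def)
    have xy: "x \<in> carrier S" "y \<in> carrier S" "e \<cdot> x = x" "e \<cdot> y = y" "x \<cdot> e = x"
      using idem_left[OF xyG(1)] idem_right[OF xyG(1)] idem_left[OF xyG(2)]
      unfolding xyG(3,4) by (simp_all add: xyG(1,2))
    have "x \<cdot> y \<cdot> (v \<cdot> u) = x \<cdot> (y \<cdot> v) \<cdot> u" using xy u(1) v(1) by (simp add: assoc)
    also have "\<dots> = e" using u v xy by simp
    finally have 1: "x \<cdot> y \<cdot> (v \<cdot> u) = e" .
    have "v \<cdot> u \<cdot> (x \<cdot> y) = v \<cdot> (u \<cdot> x) \<cdot> y" using xy u(1) v(1) by (simp add: assoc)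
    also have "\<dots> = e" using u v xy by simp
    finally have 2: "v \<cdot> u \<cdot> (x \<cdot> y) = e" .
    show ?thesis
      using char[of "x \<cdot> y" "v \<cdot> u"] 1 2 xy u v ec by (simp add: assoc[symmetric])
  qed
qed

end

lemma completely_regular_iff: "completely_regular S \<longleftrightarrow> cr_sgroup S"
proof
  assume S: "completely_regular S"
  then interpret sgroup S by (simp add: completely_regular_def)
  show "cr_sgroup S"
  proof
    fix a assume "a \<in> carrier S"
    then have "a \<in> \<Union>(subgroups S)" using S unfolding completely_regular_def by blast
    then obtain G e where G: "G \<subseteq> carrier S" "a \<in> G"
      and "group \<lparr>carrier = G, mult = smult S, one = e\<rparr>"
      unfolding subgroups_def by blast
    then interpret G: group "\<lparr>carrier = G, mult = smult S, one = e\<rparr>" by simp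
    let ?x = "inv\<^bsub>\<lparr>carrier = G, mult = smult S, one = e\<rparr>\<^esub> a"
    have "?x \<in> carrier S" using G G.inv_closed[of a] by auto
    moreover have "a \<cdot>\<^bsub>S\<^esub> ?x \<cdot>\<^bsub>S\<^esub> a = a" "a \<cdot>\<^bsub>S\<^esub> ?x = ?x \<cdot>\<^bsub>S\<^esub> a"
      using G.r_inv[of a] G.l_inv[of a] G.l_one[of a] G by simp_all
    ultimately show "\<exists>x\<in>carrier S. a \<cdot>\<^bsub>S\<^esub> x \<cdot>\<^bsub>S\<^esub> a = a \<and> a \<cdot>\<^bsub>S\<^esub> x = x \<cdot>\<^bsub>S\<^esub> a" by blast
  qed
next
  assume "cr_sgroup S"
  then interpret cr_sgroup S .
  have "{b \<in> carrier S. idem b = idem a} \<in> subgroups S" if "a \<in> carrier S" for a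
    using subgroup_of_idempotent[OF idempotents_idem[OF that]] by (auto simp: subgroups_def)
  then have "carrier S \<subseteq> \<Union>(subgroups S)" by blast
  then show "completely_regular S"
    by (auto simp: completely_regular_def sgroup_axioms subgroups_def)
qed

section \<open>Cryptogroup quotients and the congruence \<open>kappa\<close>\<close>

context cr_sgroup
begin

lemma cr_sgroup_quot:
  assumes "congruence S \<rho>"
  shows "cr_sgroup (quot_sgrp S \<rho>)"
proof -
  interpret T: sgroup "quot_sgrp S \<rho>" using sgroup_quot[OF sgroup_axioms assms] .
  show ?thesis
  proof
    fix A assume "A \<in> carrier (quot_sgrp S \<rho>)"
    then obtain a where "a \<in> carrier S" "A = \<rho> `` {a}" by (auto simp: quot_carrier)
    then show "\<exists>X\<in>carrier (quot_sgrp S \<rho>). A \<cdot>\<^bsub>quot_sgrp S \<rho>\<^esub> X \<cdot>\<^bsub>quot_sgrp S \<rho>\<^esub> A = A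
        \<and> A \<cdot>\<^bsub>quot_sgrp S \<rho>\<^esub> X = X \<cdot>\<^bsub>quot_sgrp S \<rho>\<^esub> A"
      by (intro bexI[of _ "\<rho> `` {inverse_of a}"])
        (simp_all add: quot_sgrp_mult[OF assms] inverse_of_regular inverse_of_commute
          quot_class_in_carrier)
  qed
qed

lemma idem_quot:
  assumes "congruence S \<rho>" "a \<in> carrier S"
  shows "cr_sgroup.idem (quot_sgrp S \<rho>) (\<rho> `` {a}) = \<rho> `` {idem a}"
proof -
  interpret T: cr_sgroup "quot_sgrp S \<rho>" using cr_sgroup_quot[OF assms(1)] .
  show ?thesis
    using T.idem_unique[of "\<rho> `` {a}" "\<rho> `` {inverse_of a}"] assms
    by (simp add: quot_sgrp_mult inverse_of_regular inverse_of_commute quot_class_in_carrier idem_def)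
qed

text \<open>By \<open>green_H_iff\<close>, \<open>\<H>\<close> is the equivalence induced by the map
  \<open>idem\<close>. It is compatible with products exactly when \<open>idem (a \<cdot> b)\<close>
  depends only on \<open>idem a\<close> and \<open>idem b\<close>.\<close>

lemma cryptogroup_iff:
  "cryptogroup S \<longleftrightarrow> (\<forall>a\<in>carrier S. \<forall>b\<in>carrier S. idem (a \<cdot> b) = idem (idem a \<cdot> idem b))"
proof
  assume "cryptogroup S"
  then have H: "congruence S (green_H S)" by (simp add: cryptogroup_def)
  show "\<forall>a\<in>carrier S. \<forall>b\<in>carrier S. idem (a \<cdot> b) = idem (idem a \<cdot> idem b)"
  proof (intro ballI)
    fix a b assume ab: "a \<in> carrier S" "b \<in> carrier S"
    then have "(a, idem a) \<in> green_H S" "(b, idem b) \<in> green_H S"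
      by (simp_all add: green_H_iff)
    then have "(a \<cdot> b, idem a \<cdot> idem b) \<in> green_H S" by (rule congruence_mult[OF H])
    then show "idem (a \<cdot> b) = idem (idem a \<cdot> idem b)" using ab by (simp add: green_H_iff)
  qed
next
  assume *: "\<forall>a\<in>carrier S. \<forall>b\<in>carrier S. idem (a \<cdot> b) = idem (idem a \<cdot> idem b)"
  have sub: "green_H S \<subseteq> carrier S \<times> carrier S" by (auto simp: green_H_def green_L_def)
  have "congruence S (green_H S)"
  proof (rule congruenceI[OF sub])
    fix a b c d assume "(a, b) \<in> green_H S" "(c, d) \<in> green_H S"
    with sub have "a \<in> carrier S" "b \<in> carrier S" "c \<in> carrier S" "d \<in> carrier S"
      "idem a = idem b" "idem c = idem d" by (auto simp: green_H_iff)
    moreover from this have "idem (a \<cdot> c) = idem (b \<cdot> d)" using * by metis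
    ultimately show "(a \<cdot> c, b \<cdot> d) \<in> green_H S" by (simp add: green_H_iff)
  qed (auto simp: green_H_def green_L_def green_R_def)
  then show "cryptogroup S"
    by (simp add: cryptogroup_def completely_regular_iff cr_sgroup_axioms)
qed

text \<open>The pairs required to lie in \<open>\<rho>\<close> do not depend on
  \<open>\<rho>\<close>, so the criterion passes to intersections and to larger congruences.\<close>

lemma cryptogroup_quot_iff:
  assumes "congruence S \<rho>"
  shows "cryptogroup (quot_sgrp S \<rho>) \<longleftrightarrow>
    (\<forall>a\<in>carrier S. \<forall>b\<in>carrier S. (idem (a \<cdot> b), idem (idem a \<cdot> idem b)) \<in> \<rho>)"
proof -
  interpret T: cr_sgroup "quot_sgrp S \<rho>" using cr_sgroup_quot[OF assms] .
  have all: "(\<forall>A\<in>carrier (quot_sgrp S \<rho>). P A) \<longleftrightarrow> (\<forall>a\<in>carrier S. P (\<rho> `` {a}))" for P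
    by (auto simp: quot_carrier)
  have "cryptogroup (quot_sgrp S \<rho>) \<longleftrightarrow>
    (\<forall>a\<in>carrier S. \<forall>b\<in>carrier S. \<rho> `` {idem (a \<cdot> b)} = \<rho> `` {idem (idem a \<cdot> idem b)})"
    unfolding T.cryptogroup_iff all by (simp add: idem_quot[OF assms] quot_sgrp_mult[OF assms])
  then show ?thesis by (simp add: quot_class_eq_iff[OF assms])
qed

lemma cryptogroup_congruence_omega:
  "congruence S (omega S) \<and> cryptogroup (quot_sgrp S (omega S))"
  by (simp add: congruence_omega sgroup_axioms cryptogroup_quot_iff) (simp add: omega_def)

text \<open>This shows that the \<open>LEAST\<close> defining \<open>kappa\<close> exists: the
  family contains \<open>omega S\<close>, and its intersection again satisfies the cryptogroup
  criterion.\<close>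

lemma kappa_eq: "kappa S = \<Inter>{\<sigma>. congruence S \<sigma> \<and> cryptogroup (quot_sgrp S \<sigma>)}"
proof -
  let ?F = "{\<sigma>. congruence S \<sigma> \<and> cryptogroup (quot_sgrp S \<sigma>)}"
  have cong: "congruence S (\<Inter>?F)"
    using cryptogroup_congruence_omega by (intro congruence_Inter) blast+
  moreover have "cryptogroup (quot_sgrp S (\<Inter>?F))"
    using cryptogroup_quot_iff by (auto simp: cryptogroup_quot_iff[OF cong])
  ultimately show ?thesis
    unfolding kappa_def by (intro Least_equality) auto
qed

lemma
  shows congruence_kappa: "congruence S (kappa S)"
    and cryptogroup_quot_kappa: "cryptogroup (quot_sgrp S (kappa S))"
proof -
  let ?F = "{\<sigma>. congruence S \<sigma> \<and> cryptogroup (quot_sgrp S \<sigma>)}"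
  show cong: "congruence S (kappa S)"
    unfolding kappa_eq using cryptogroup_congruence_omega by (intro congruence_Inter) blast+
  show "cryptogroup (quot_sgrp S (kappa S))"
    using cryptogroup_quot_iff by (auto simp: cryptogroup_quot_iff[OF cong]) (auto simp: kappa_eq)
qed

lemma kappa_least: "congruence S \<sigma> \<Longrightarrow> cryptogroup (quot_sgrp S \<sigma>) \<Longrightarrow> kappa S \<subseteq> \<sigma>"
  by (auto simp: kappa_eq)

section \<open>Lower kernels, the least band congruence and its trace\<close>

lemma
  assumes "congruence S \<rho>"
  shows congruence_lower_kernel: "congruence S (lower_kernel S \<rho>)"
    and cong_kernel_lower_kernel: "cong_kernel S (lower_kernel S \<rho>) = cong_kernel S \<rho>"
    and lower_kernel_least:
      "\<And>\<sigma>. congruence S \<sigma> \<Longrightarrow> cong_kernel S \<rho> \<subseteq> cong_kernel S \<sigma> \<Longrightarrow> lower_kernel S \<rho> \<subseteq> \<sigma>"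
proof -
  \<comment> \<open>Kernels are only required to contain that of \<open>\<rho>\<close>. The
    intersection still has exactly this kernel, since \<open>\<rho>\<close> is a member, and it is
    then least in the larger family.\<close>
  let ?F = "{\<sigma>. congruence S \<sigma> \<and> cong_kernel S \<rho> \<subseteq> cong_kernel S \<sigma>}"
  have cong: "congruence S (\<Inter>?F)"
    using assms by (intro congruence_Inter) blast+
  have "a \<in> cong_kernel S (\<Inter>?F) \<longleftrightarrow> a \<in> cong_kernel S \<rho>" if a: "a \<in> carrier S" for a
    using assms cong_kernel_iff[OF _ a] unfolding cong_kernel_iff[OF cong a] by blast
  then have ker: "cong_kernel S (\<Inter>?F) = cong_kernel S \<rho>"
    using cong_kernel_carrier by blast
  have eq: "lower_kernel S \<rho> = \<Inter>?F"
    unfolding lower_kernel_def using cong ker by (intro Least_equality) auto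
  show "congruence S (lower_kernel S \<rho>)" "cong_kernel S (lower_kernel S \<rho>) = cong_kernel S \<rho>"
    using cong ker by (simp_all add: eq)
  show "lower_kernel S \<rho> \<subseteq> \<sigma>"
    if "congruence S \<sigma>" "cong_kernel S \<rho> \<subseteq> cong_kernel S \<sigma>" for \<sigma>
    using that by (auto simp: eq)
qed

text \<open>Having all of \<open>S\<close> as kernel means relating every \<open>a\<close> to
  \<open>idem a\<close>, that is, having a band as quotient.\<close>

abbreviation band_congruence :: "'a rel" where
  "band_congruence \<equiv> lower_kernel S (omega S)"

lemma cong_omega: "congruence S (omega S)"
  using congruence_omega sgroup_axioms by blast

lemma congruence_band: "congruence S band_congruence"
  using congruence_lower_kernel[OF cong_omega] .

lemma band_congruence_idem: "a \<in> carrier S \<Longrightarrow> (a, idem a) \<in> band_congruence"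
proof -
  assume a: "a \<in> carrier S"
  then have "a \<in> cong_kernel S (omega S)"
    by (subst cong_kernel_iff[OF cong_omega a]) (simp add: omega_def)
  then show ?thesis
    using a cong_kernel_iff[OF congruence_band] cong_kernel_lower_kernel[OF cong_omega] by simp
qed

lemma band_congruence_least:
  assumes "congruence S \<sigma>" "\<And>a. a \<in> carrier S \<Longrightarrow> (a, idem a) \<in> \<sigma>"
  shows "band_congruence \<subseteq> \<sigma>"
proof (rule lower_kernel_least[OF cong_omega assms(1)])
  show "cong_kernel S (omega S) \<subseteq> cong_kernel S \<sigma>"
    using cong_kernel_carrier cong_kernel_iff[OF assms(1)] assms(2) by blast
qed

text \<open>The band congruence relates \<open>a \<cdot> b\<close> to
  \<open>idem a \<cdot> idem b\<close>. Taking \<open>idem\<close> of both sides puts every pair of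
  the cryptogroup criterion into its trace.\<close>

lemma cryptogroup_quot_if_trace:
  assumes "congruence S \<sigma>" "cong_trace S band_congruence \<subseteq> \<sigma>"
  shows "cryptogroup (quot_sgrp S \<sigma>)"
  unfolding cryptogroup_quot_iff[OF assms(1)]
proof (intro ballI)
  note B = congruence_band
  fix a b assume ab: "a \<in> carrier S" "b \<in> carrier S"
  have "(a \<cdot> b, idem a \<cdot> idem b) \<in> band_congruence"
    using congruence_mult[OF B] band_congruence_idem ab by blast
  then have "(idem (a \<cdot> b), idem (idem a \<cdot> idem b)) \<in> band_congruence"
    by (rule idem_cong[OF B])
  then have "(idem (a \<cdot> b), idem (idem a \<cdot> idem b)) \<in> cong_trace S band_congruence"
    using ab by (simp add: cong_trace_def)
  with assms(2) show "(idem (a \<cdot> b), idem (idem a \<cdot> idem b)) \<in> \<sigma>" by blast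
qed

lemma kappa_le_band: "kappa S \<subseteq> band_congruence"
  using kappa_least[OF congruence_band cryptogroup_quot_if_trace[OF congruence_band]]
  by (auto simp: cong_trace_def)

lemma trace_band_le_kappa: "cong_trace S band_congruence \<subseteq> kappa S"
proof -
  note K = congruence_kappa
  have id: "(idem (a \<cdot> b), idem (idem a \<cdot> idem b)) \<in> kappa S"
    if "a \<in> carrier S" "b \<in> carrier S" for a b
    using that cryptogroup_quot_kappa cryptogroup_quot_iff[OF K] by blast
  \<comment> \<open>This relation is a congruence by the cryptogroup criterion for
    \<open>kappa S\<close>, and it relates \<open>a\<close> to \<open>idem a\<close>. Hence it
    contains the band congruence, while on idempotents it coincides with
    \<open>kappa S\<close>.\<close>
  let ?\<pi> = "{(a, b) \<in> carrier S \<times> carrier S. (idem a, idem b) \<in> kappa S}"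
  have "congruence S ?\<pi>"
  proof (rule congruenceI)
    fix a b c d assume "(a, b) \<in> ?\<pi>" "(c, d) \<in> ?\<pi>"
    then have *: "a \<in> carrier S" "b \<in> carrier S" "c \<in> carrier S" "d \<in> carrier S"
      "(idem a, idem b) \<in> kappa S" "(idem c, idem d) \<in> kappa S" by auto
    have "(idem (idem a \<cdot> idem c), idem (idem b \<cdot> idem d)) \<in> kappa S"
      using idem_cong[OF K] congruence_mult[OF K] * by blast
    then have "(idem (a \<cdot> c), idem (b \<cdot> d)) \<in> kappa S"
      using id[OF *(1,3)] id[OF *(2,4)] congruence_trans[OF K] congruence_sym[OF K] by blast
    then show "(a \<cdot> c, b \<cdot> d) \<in> ?\<pi>" using * by simp
  qed (auto intro: congruence_refl[OF K] congruence_trans[OF K] congruence_sym[OF K])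
  then have "band_congruence \<subseteq> ?\<pi>"
    by (rule band_congruence_least) (simp add: congruence_refl[OF K])
  then show ?thesis by (force simp: cong_trace_def)
qed

lemma lower_trace_band: "lower_trace S band_congruence = kappa S"
  unfolding lower_trace_def
proof (rule Least_equality)
  show "congruence S (kappa S) \<and> cong_trace S (kappa S) = cong_trace S band_congruence"
    using congruence_kappa kappa_le_band trace_band_le_kappa by (auto simp: cong_trace_def)
next
  fix \<sigma> assume "congruence S \<sigma> \<and> cong_trace S \<sigma> = cong_trace S band_congruence"
  then show "kappa S \<subseteq> \<sigma>"
    by (intro kappa_least cryptogroup_quot_if_trace) (auto simp: cong_trace_def)
qed

section \<open>Green's J-order, its meets and its stability\<close>

text \<open>Green's \<open>\<J>\<close>-preorder. The unitless form \<open>SbS\<close> loses nothing because \<open>b = b\<^sup>0bb\<^sup>0\<close>.\<close>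

definition J_le :: "'a \<Rightarrow> 'a \<Rightarrow> bool" where
  "J_le a b \<longleftrightarrow> (\<exists>x\<in>carrier S. \<exists>y\<in>carrier S. a = x \<cdot> b \<cdot> y)"

lemma J_leI: "x \<in> carrier S \<Longrightarrow> y \<in> carrier S \<Longrightarrow> a = x \<cdot> b \<cdot> y \<Longrightarrow> J_le a b"
  by (auto simp: J_le_def)

lemma J_le_refl: "a \<in> carrier S \<Longrightarrow> J_le a a"
  by (rule J_leI[of "idem a" "idem a"]) simp_all

lemma J_le_trans:
  assumes "J_le a b" "J_le b c" "c \<in> carrier S"
  shows "J_le a c"
proof -
  from assms obtain x y u v where *: "x \<in> carrier S" "y \<in> carrier S" "u \<in> carrier S" "v \<in> carrier S"
    "a = x \<cdot> b \<cdot> y" "b = u \<cdot> c \<cdot> v" unfolding J_le_def by blast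
  then have "a = (x \<cdot> u) \<cdot> c \<cdot> (v \<cdot> y)" using assms(3) by (simp add: assoc)
  then show ?thesis by (rule J_leI[rotated 2]) (simp_all add: *(1-4))
qed

lemma J_le_mult1: "a \<in> carrier S \<Longrightarrow> b \<in> carrier S \<Longrightarrow> J_le (a \<cdot> b) a"
  by (rule J_leI[of "idem a" b]) simp_all

lemma J_le_mult2: "a \<in> carrier S \<Longrightarrow> b \<in> carrier S \<Longrightarrow> J_le (a \<cdot> b) b"
  by (rule J_leI[of a "idem b"]) (simp_all add: assoc)

lemma J_le_square: "a \<in> carrier S \<Longrightarrow> J_le a (a \<cdot> a)"
  by (rule J_leI[of "inverse_of a" "idem a"])
    (simp_all add: idem_inverse_left flip: assoc)

text \<open>The square of \<open>ab\<close> is \<open>a(ba)b\<close>, and an element lies below its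
  own square.\<close>

lemma J_le_commute:
  assumes "a \<in> carrier S" "b \<in> carrier S"
  shows "J_le (a \<cdot> b) (b \<cdot> a)"
proof -
  have "J_le (a \<cdot> b \<cdot> (a \<cdot> b)) (b \<cdot> a)"
    using assms by (intro J_leI[of a b]) (simp_all add: assoc)
  with J_le_square[of "a \<cdot> b"] show ?thesis
    using J_le_trans[of "a \<cdot> b" "a \<cdot> b \<cdot> (a \<cdot> b)" "b \<cdot> a"] assms by simp
qed

text \<open>Products are meets in the J-preorder; this makes J-equivalence a congruence with
  semilattice quotient.\<close>

lemma J_le_mult_iff:
  assumes a: "a \<in> carrier S" and b: "b \<in> carrier S" and c: "c \<in> carrier S"
  shows "J_le c (a \<cdot> b) \<longleftrightarrow> J_le c a \<and> J_le c b"
proof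
  assume "J_le c (a \<cdot> b)"
  then show "J_le c a \<and> J_le c b"
    using J_le_trans[OF _ J_le_mult1[OF a b] a] J_le_trans[OF _ J_le_mult2[OF a b] b] by simp
next
  assume "J_le c a \<and> J_le c b"
  then obtain x y u v where *: "x \<in> carrier S" "y \<in> carrier S" "u \<in> carrier S" "v \<in> carrier S"
    "c = x \<cdot> a \<cdot> y" "c = u \<cdot> b \<cdot> v" unfolding J_le_def by blast
  \<comment> \<open>Squaring \<open>c\<close> puts a multiple of \<open>b\<close> in front of
    \<open>a\<close>. Commuting the factors of \<open>?m \<cdot> a\<close> gives
    \<open>a \<cdot> ?m\<close>, which begins with \<open>a \<cdot> b\<close>.\<close>
  let ?m = "b \<cdot> (v \<cdot> x)"
  have "c \<cdot> c = (u \<cdot> b \<cdot> v) \<cdot> (x \<cdot> a \<cdot> y)" using *(5,6) by simp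
  also have "\<dots> = u \<cdot> (?m \<cdot> a) \<cdot> y"
    using *(1-4) a b by (simp add: assoc)
  finally have "c \<cdot> c = u \<cdot> (?m \<cdot> a) \<cdot> y" .
  then have "J_le (c \<cdot> c) (?m \<cdot> a)"
    by (rule J_leI[rotated 2]) (simp_all add: *(2,3))
  with J_le_square[OF c] have "J_le c (?m \<cdot> a)"
    by (rule J_le_trans) (simp add: *(1-4) a b)
  moreover have "J_le (?m \<cdot> a) (a \<cdot> ?m)"
    by (rule J_le_commute) (simp_all add: *(1-4) a b)
  ultimately have "J_le c (a \<cdot> ?m)"
    by (rule J_le_trans) (simp add: *(1-4) a b)
  moreover have "J_le (a \<cdot> ?m) (a \<cdot> b)"
    using J_le_mult1[of "a \<cdot> b" "v \<cdot> x"] *(1,4) a b by (simp add: assoc)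
  ultimately show "J_le c (a \<cdot> b)"
    by (rule J_le_trans) (simp add: a b)
qed

lemma congruence_J:
  "congruence S {(a, b) \<in> carrier S \<times> carrier S. J_le a b \<and> J_le b a}" (is "congruence S ?J")
proof (rule congruenceI)
  fix a b c assume "(a, b) \<in> ?J" "(b, c) \<in> ?J"
  then show "(a, c) \<in> ?J" using J_le_trans by blast
next
  fix a b c d assume "(a, b) \<in> ?J" "(c, d) \<in> ?J"
  then show "(a \<cdot> c, b \<cdot> d) \<in> ?J"
    using J_le_trans[OF J_le_mult1] J_le_trans[OF J_le_mult2] by (simp add: J_le_mult_iff)
qed (auto simp: J_le_refl)

lemma J_le_idem:
  assumes "a \<in> carrier S"
  shows "J_le a (idem a)" "J_le (idem a) a"
  using J_le_mult1[of "idem a" a] J_le_mult1[of a "inverse_of a"] assms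
  by (simp_all add: idem_def inverse_of_regular)

text \<open>J-equivalence relates \<open>a\<close> to \<open>idem a\<close>, so it contains the
  least band congruence, which contains \<open>kappa S\<close>.\<close>

lemma kappa_le_J:
  assumes "(a, b) \<in> kappa S"
  shows "J_le a b"
proof -
  have "band_congruence \<subseteq> {(a, b) \<in> carrier S \<times> carrier S. J_le a b \<and> J_le b a}"
    by (rule band_congruence_least[OF congruence_J]) (simp add: J_le_idem)
  with assms kappa_le_band show ?thesis by blast
qed

text \<open>Stability of \<open>\<J>\<close>: \<open>a = uav\<close> gives \<open>a = av\<^sup>0\<close>.\<close>

lemma J_le_stable:
  assumes a: "a \<in> carrier S" and b: "b \<in> carrier S" and "J_le a (a \<cdot> b)"
  shows "\<exists>s\<in>carrier S. a = a \<cdot> b \<cdot> s"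
proof -
  from assms obtain u q where uq: "u \<in> carrier S" "q \<in> carrier S" "a = u \<cdot> (a \<cdot> b) \<cdot> q"
    by (auto simp: J_le_def)
  define v where "v = b \<cdot> q"
  have v: "v \<in> carrier S" "a = u \<cdot> a \<cdot> v"
    using uq a b by (simp_all add: v_def assoc)
  have "a = a \<cdot> idem v"
    using v uq(1) a by (metis assoc closed idem_closed idem_right)
  also have "\<dots> = a \<cdot> b \<cdot> (q \<cdot> inverse_of v)"
    using uq a b v(1) by (simp add: idem_def) (simp add: v_def assoc)
  finally show ?thesis using uq v by (meson closed inverse_of_closed)
qed

section \<open>Rectangular band classes and kernels in quotients\<close>

lemma over_rectangular_bands_iff:
  "over_rectangular_bands S (kappa S) \<longleftrightarrow> cong_kernel S (kappa S) \<subseteq> idempotents S"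
proof
  note K = congruence_kappa
  assume *: "over_rectangular_bands S (kappa S)"
  show "cong_kernel S (kappa S) \<subseteq> idempotents S"
  proof
    fix a assume "a \<in> cong_kernel S (kappa S)"
    then obtain e where a: "a \<in> carrier S" and e: "e \<in> idempotents S" "(a, e) \<in> kappa S"
      by (auto simp: cong_kernel_def)
    let ?B = "\<lparr>carrier = kappa S `` {e}, smult = smult S\<rparr>"
    have B: "rectangular_band ?B" using * e(1) by (simp add: over_rectangular_bands_def)
    then have aB: "a \<in> carrier ?B" "a \<cdot> a \<in> carrier ?B"
      using congruence_sym[OF K e(2)] sgroup.closed[of ?B a a] by (simp_all add: rectangular_band_def)
    \<comment> \<open>The rectangular identity with \<open>x = a\<close> and with
      \<open>x = aa\<close>; comparing \<open>a = aaa\<close> with \<open>a = aaaa\<close> gives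
      \<open>a = aa\<close>.\<close>
    have cube: "a = a \<cdot> a \<cdot> a" and four: "a = a \<cdot> (a \<cdot> a) \<cdot> a"
      using B aB by (simp_all add: rectangular_band_def)
    have "a = (a \<cdot> a \<cdot> a) \<cdot> a" using four a by (simp add: assoc)
    then have "a = a \<cdot> a" using cube by simp
    then show "a \<in> idempotents S" using a by (simp add: idempotents_def)
  qed
next
  note K = congruence_kappa
  assume *: "cong_kernel S (kappa S) \<subseteq> idempotents S"
  show "over_rectangular_bands S (kappa S)"
    unfolding over_rectangular_bands_def rectangular_band_def
  proof (intro ballI conjI, unfold_locales; simp)
    fix e assume e: "e \<in> idempotents S"
    show mult: "(e, a \<cdot> b) \<in> kappa S" if "(e, a) \<in> kappa S" "(e, b) \<in> kappa S" for a b
      using congruence_mult[OF K that] e by (simp add: idempotents_def)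
    show "a \<cdot> b \<cdot> c = a \<cdot> (b \<cdot> c)" if "(e, a) \<in> kappa S" "(e, b) \<in> kappa S" "(e, c) \<in> kappa S" for a b c
      using congruence_ran[OF K] that by (simp add: assoc)
    have idem: "a \<in> idempotents S" if "(e, a) \<in> kappa S" for a
      using that * e congruence_ran[OF K that] congruence_sym[OF K that] by (auto simp: cong_kernel_def)
    show "a = a \<cdot> x \<cdot> a" if a: "(e, a) \<in> kappa S" and x: "(e, x) \<in> kappa S" for a x
    proof -
      have xa: "(e, x \<cdot> a) \<in> kappa S" and axa: "(e, a \<cdot> (x \<cdot> a)) \<in> kappa S"
        using mult a x by blast+
      have c: "a \<in> carrier S" "x \<in> carrier S" using a x congruence_ran[OF K] by blast+
      \<comment> \<open>Both elements lie in the class of \<open>e\<close>, so they are J-related,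
        and stability yields \<open>a = fs\<close> with \<open>f = axa\<close>. Idempotency of
        \<open>f\<close> then gives \<open>fa = a\<close>, that of \<open>a\<close> gives
        \<open>fa = f\<close>, and so \<open>a = axa\<close>.\<close>
      have "J_le a (a \<cdot> (x \<cdot> a))"
        using a axa congruence_sym[OF K] congruence_trans[OF K] kappa_le_J by blast
      then obtain s where s: "s \<in> carrier S" "a = a \<cdot> (x \<cdot> a) \<cdot> s"
        using J_le_stable[of a "x \<cdot> a"] c by auto
      let ?f = "a \<cdot> (x \<cdot> a)"
      have f: "?f \<cdot> ?f = ?f" using idem[OF axa] by (simp add: idempotents_def)
      have "?f \<cdot> a = ?f \<cdot> (?f \<cdot> s)" using s by simp
      also have "\<dots> = ?f \<cdot> ?f \<cdot> s" by (rule assoc[symmetric]) (simp_all add: s(1) c)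
      also have "\<dots> = a" unfolding f by (rule s(2)[symmetric])
      finally have "?f \<cdot> a = a" .
      moreover have "a \<cdot> a = a" using idem[OF a] by (simp add: idempotents_def)
      then have "?f \<cdot> a = ?f" using c by (simp add: assoc)
      ultimately show ?thesis using c by (simp add: assoc)
    qed
  qed
qed

text \<open>The pullback of \<open>kappa\<close> of the quotient satisfies the cryptogroup criterion
  on \<open>S\<close>, hence contains \<open>kappa S\<close>; the pair formed by \<open>a\<close>
  and \<open>idem a\<close> can then be projected.\<close>

lemma kernel_quot_kappa:
  assumes \<rho>: "congruence S \<rho>" and a: "a \<in> cong_kernel S (kappa S)"
  shows "\<rho> `` {a} \<in> cong_kernel (quot_sgrp S \<rho>) (kappa (quot_sgrp S \<rho>))"
proof -
  let ?T = "quot_sgrp S \<rho>"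
  interpret T: cr_sgroup ?T using cr_sgroup_quot[OF \<rho>] .
  note K = T.congruence_kappa
  let ?\<kappa> = "{(a, b) \<in> carrier S \<times> carrier S. (\<rho> `` {a}, \<rho> `` {b}) \<in> kappa ?T}"
  have pull: "congruence S ?\<kappa>" by (rule congruence_pullback[OF sgroup_axioms \<rho> K])
  have "cryptogroup (quot_sgrp S ?\<kappa>)"
    unfolding cryptogroup_quot_iff[OF pull]
  proof (intro ballI)
    fix a b assume ab: "a \<in> carrier S" "b \<in> carrier S"
    have "(T.idem (\<rho> `` {a} \<cdot>\<^bsub>?T\<^esub> \<rho> `` {b}), T.idem (T.idem (\<rho> `` {a}) \<cdot>\<^bsub>?T\<^esub> T.idem (\<rho> `` {b}))) \<in> kappa ?T"
      using T.cryptogroup_quot_kappa T.cryptogroup_quot_iff[OF K] ab by (simp add: quot_class_in_carrier)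
    then show "(idem (a \<cdot> b), idem (idem a \<cdot> idem b)) \<in> ?\<kappa>"
      using ab by (simp add: idem_quot[OF \<rho>] quot_sgrp_mult[OF \<rho>])
  qed
  then have "kappa S \<subseteq> ?\<kappa>" by (rule kappa_least[OF pull])
  moreover have a': "a \<in> carrier S" "(a, idem a) \<in> kappa S"
    using a cong_kernel_carrier cong_kernel_iff[OF congruence_kappa] by blast+
  ultimately show ?thesis
    using T.cong_kernel_iff[OF K] by (auto simp: idem_quot[OF \<rho>] quot_class_in_carrier)
qed

text \<open>For \<open>\<rho> \<subseteq> kappa S\<close>, the congruence
  \<open>kappa S / \<rho>\<close> has a cryptogroup quotient and so contains \<open>kappa\<close> of
  \<open>S/\<rho>\<close>; pairs of classes then lift to pairs in \<open>kappa S\<close>.\<close>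

lemma kernel_quot_kappa_converse:
  assumes \<rho>: "congruence S \<rho>" "\<rho> \<subseteq> kappa S" and a: "a \<in> carrier S"
    and mem: "\<rho> `` {a} \<in> cong_kernel (quot_sgrp S \<rho>) (kappa (quot_sgrp S \<rho>))"
  shows "a \<in> cong_kernel S (kappa S)"
proof -
  let ?T = "quot_sgrp S \<rho>"
  interpret T: cr_sgroup ?T using cr_sgroup_quot[OF \<rho>(1)] .
  note K = congruence_kappa
  note push = congruence_pushforward[OF \<rho>(1) K \<rho>(2)]
  note iff = pushforward_iff[OF \<rho>(1) K \<rho>(2)]
  have "cryptogroup (quot_sgrp ?T (pushforward \<rho> (kappa S)))"
    unfolding T.cryptogroup_quot_iff[OF push]
    using cryptogroup_quot_kappa cryptogroup_quot_iff[OF K]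
    by (auto simp: quot_carrier idem_quot[OF \<rho>(1)] quot_sgrp_mult[OF \<rho>(1)] iff)
  then have "kappa ?T \<subseteq> pushforward \<rho> (kappa S)" by (rule T.kappa_least[OF push])
  moreover have "(\<rho> `` {a}, \<rho> `` {idem a}) \<in> kappa ?T"
    using mem T.cong_kernel_iff[OF T.congruence_kappa] a
    by (simp add: idem_quot[OF \<rho>(1)] quot_class_in_carrier)
  ultimately show ?thesis
    using iff[of a "idem a"] a cong_kernel_iff[OF K a] by auto
qed

text \<open>Idempotent classes are those containing an idempotent of \<open>S\<close>, because
  \<open>idem\<close> commutes with the projection. This translates the kernel criterion for
  rectangular bands back to \<open>S\<close>.\<close>

lemma idempotent_quot_iff:
  assumes "congruence S \<rho>" "a \<in> carrier S"
  shows "\<rho> `` {a} \<in> idempotents (quot_sgrp S \<rho>) \<longleftrightarrow> a \<in> cong_kernel S \<rho>"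
proof -
  interpret T: cr_sgroup "quot_sgrp S \<rho>" using cr_sgroup_quot[OF assms(1)] .
  have "\<rho> `` {a} \<in> idempotents (quot_sgrp S \<rho>) \<longleftrightarrow> T.idem (\<rho> `` {a}) = \<rho> `` {a}"
    using T.idem_of_idempotent T.idempotents_idem quot_class_in_carrier[OF assms(2)] by metis
  then show ?thesis
    using assms quot_class_eq_iff[of S \<rho> a "idem a"] by (auto simp: idem_quot cong_kernel_iff)
qed

end

theorem corollary3p6:
  fixes S :: "'a sgrp"
  assumes "completely_regular S"
  shows "lower_kernel S (kappa S) = lower_kernel S (lower_trace S (lower_kernel S (omega S)))
    \<and> congruence S (lower_kernel S (kappa S))
    \<and> over_rectangular_bands (quot_sgrp S (lower_kernel S (kappa S)))
        (kappa (quot_sgrp S (lower_kernel S (kappa S))))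
    \<and> (\<forall>\<rho>. congruence S \<rho> \<and> over_rectangular_bands (quot_sgrp S \<rho>) (kappa (quot_sgrp S \<rho>))
          \<longrightarrow> lower_kernel S (kappa S) \<subseteq> \<rho>)"
proof (intro conjI allI impI)
  interpret cr_sgroup S using assms completely_regular_iff by blast
  note K = congruence_kappa
  let ?k = "lower_kernel S (kappa S)"
  show "?k = lower_kernel S (lower_trace S (lower_kernel S (omega S)))"
    by (simp add: lower_trace_band)
  show k: "congruence S ?k" by (rule congruence_lower_kernel[OF K])
  interpret T: cr_sgroup "quot_sgrp S ?k" using cr_sgroup_quot[OF k] .
  \<comment> \<open>\<open>kappa S\<close> itself has the prescribed kernel. The inclusion is what
    allows \<open>kappa S\<close> to be pushed forward to the quotient by \<open>?k\<close>.\<close>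
  have le: "?k \<subseteq> kappa S" using lower_kernel_least[OF K K] by simp
  show "over_rectangular_bands (quot_sgrp S ?k) (kappa (quot_sgrp S ?k))"
    unfolding T.over_rectangular_bands_iff
  proof
    fix A assume A: "A \<in> cong_kernel (quot_sgrp S ?k) (kappa (quot_sgrp S ?k))"
    then obtain a where a: "a \<in> carrier S" "A = ?k `` {a}"
      using T.cong_kernel_carrier by (force simp: quot_carrier)
    \<comment> \<open>The converse lemma places \<open>a\<close> in the kernel of
      \<open>kappa S\<close>, which by construction is also the kernel of \<open>?k\<close>, so the
      class of \<open>a\<close> is idempotent.\<close>
    then have "a \<in> cong_kernel S ?k"
      using kernel_quot_kappa_converse[OF k le] A cong_kernel_lower_kernel[OF K] by simp
    then show "A \<in> idempotents (quot_sgrp S ?k)"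
      using a idempotent_quot_iff[OF k] by simp
  qed
next
  interpret cr_sgroup S using assms completely_regular_iff by blast
  fix \<rho>
  assume *: "congruence S \<rho> \<and> over_rectangular_bands (quot_sgrp S \<rho>) (kappa (quot_sgrp S \<rho>))"
  then interpret T: cr_sgroup "quot_sgrp S \<rho>" using cr_sgroup_quot by blast
  \<comment> \<open>An element of the kernel of \<open>kappa S\<close> projects into the kernel of
    \<open>kappa\<close> of the quotient, which consists of idempotents by hypothesis; an idempotent
    class means membership in the kernel of \<open>\<rho>\<close>.\<close>
  have "cong_kernel S (kappa S) \<subseteq> cong_kernel S \<rho>"
    using * kernel_quot_kappa idempotent_quot_iff cong_kernel_carrier
    unfolding T.over_rectangular_bands_iff by blast
  then show "lower_kernel S (kappa S) \<subseteq> \<rho>"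
    using lower_kernel_least[OF congruence_kappa] * by blast
qed

end
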